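(* There are no barely independent families in $\omega$.
   Context: Notation: for $A\subseteq\omega$, put $A^0=A$ and $A^1=\omega\setminus A$. For a family $\mathcal{A}$ of subsets of $\omega$ and $h:\mathcal{A}\to 2=\{0,1\}$, put $\mathcal{A}^h=\{A^{h(A)} : A\in\mathcal{A}\}$. Definition: a family $\mathcal{I}$ of infinite subsets of $\omega$ is barely independent (in $\omega$) if $\mathcal{I}$ is infinite and (i) $\bigcap\mathcal{A}^h$ is infinite for every finite $\mathcal{A}\subseteq\mathcal{I}$ and every $h:\mathcal{A}\to 2$ (the empty intersection being $\omega$); (ii) $\bigcap\mathcal{A}^h$ is finite for every countably infinite $\mathcal{A}\subseteq\mathcal{I}$ and every $h:\mathcal{A}\to 2$. *)

theory Defs
  imports "HOL-Library.Countable_Set" "HOL-Library.FuncSet"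
begin

(* A^0 = A and A^1 = omega - A, with omega rendered as the type nat; only the
   exponents 0 and 1 are used. *)
definition set_exp :: "nat set \<Rightarrow> nat \<Rightarrow> nat set" where
  "set_exp A i = (if i = 0 then A else UNIV - A)"

definition family_exp :: "nat set set \<Rightarrow> (nat set \<Rightarrow> nat) \<Rightarrow> nat set set" where
  "family_exp \<A> h = {set_exp A (h A) | A. A \<in> \<A>}"

(* The intersection of the empty family is UNIV. *)
definition barely_independent :: "nat set set \<Rightarrow> bool" where
  "barely_independent \<I> \<longleftrightarrow>
     infinite \<I> \<and>
     (\<forall>A\<in>\<I>. infinite A) \<and>
     (\<forall>\<A> h. \<A> \<subseteq> \<I> \<and> finite \<A> \<and> h \<in> \<A> \<rightarrow> {0, 1} \<longrightarrow> infinite (\<Inter>(family_exp \<A> h))) \<and>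
     (\<forall>\<A> h. \<A> \<subseteq> \<I> \<and> countable \<A> \<and> infinite \<A> \<and> h \<in> \<A> \<rightarrow> {0, 1} \<longrightarrow>
        finite (\<Inter>(family_exp \<A> h)))"

end

theory Submission
  imports Defs "HOL-Library.Diagonal_Subsequence"
begin

text \<open>
  Thin out a sequence of distinct members of a putative barely independent family until it
  converges pointwise to a set \<open>D\<close>. Either every intersection of finitely many terms meets \<open>D\<close>
  in an infinite set, or some such intersection has finite trace on \<open>D\<close>, and then, by
  independence, every finite intersection of complements of later terms meets the complement
  of \<open>D\<close> in an infinite set. In both cases one picks alternately points of \<open>D\<close> (respectively of
  its complement) and terms of the sequence, so that every chosen point lies in every chosen
  term (respectively in its complement). The chosen terms contradict condition (ii).
\<close>

lemma constant_subsequence: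
  fixes P :: "nat \<Rightarrow> bool"
  shows "\<exists>r :: nat \<Rightarrow> nat. strict_mono r \<and> ((\<forall>i. P (r i)) \<or> (\<forall>i. \<not> P (r i)))"
proof (cases "infinite {i. P i}")
  case True
  then show ?thesis
    using infinite_enumerate[OF True] by auto
next
  case False
  then have "infinite {i. \<not> P i}"
    using finite_Un[of "{i. P i}" "{i. \<not> P i}"] by (auto simp: Un_def)
  then show ?thesis
    using infinite_enumerate[of "{i. \<not> P i}"] by auto
qed

text \<open>This is sequential compactness of the Cantor space, by diagonalisation: stage
  \<open>n\<close> passes to a subsequence along which membership of \<open>n\<close> is
  constant.\<close>

lemma pointwise_convergent_subsequence:
  fixes A :: "nat \<Rightarrow> nat set"
  shows "\<exists>(r :: nat \<Rightarrow> nat) D. strict_mono r \<and> (\<forall>n. \<forall>\<^sub>F i in sequentially. n \<in> A (r i) \<longleftrightarrow> n \<in> D)"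
proof -
  define P where "P n s \<longleftrightarrow> (\<forall>i. n \<in> A (s i)) \<or> (\<forall>i. n \<notin> A (s i))" for n and s :: "nat \<Rightarrow> nat"
  interpret subseqs P
  proof
    fix n and s :: "nat \<Rightarrow> nat"
    show "\<exists>r'. strict_mono r' \<and> P n (s \<circ> r')"
      using constant_subsequence[of "\<lambda>i. n \<in> A (s i)"] by (auto simp: P_def)
  qed
  have P: "P n (diagseq \<circ> ((+) (Suc n)))" for n
    by (rule diagseq_holds) (auto simp: P_def)
  \<comment> \<open>By \<open>P\<close>, membership of \<open>n\<close> no longer changes from index
    \<open>Suc n\<close> on, so its value there is the limit value.\<close>
  define D where "D = {n. n \<in> A (diagseq (Suc n))}"
  have "n \<in> A (diagseq i) \<longleftrightarrow> n \<in> D" if le: "i \<ge> Suc n" for n i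
  proof -
    obtain k where "i = Suc n + k"
      using le_Suc_ex[OF le] by blast
    moreover have "n \<in> A (diagseq (Suc n + k)) \<longleftrightarrow> n \<in> A (diagseq (Suc n + 0))"
      using P[of n] unfolding P_def o_def by blast
    ultimately show ?thesis
      by (simp add: D_def)
  qed
  then have "\<forall>\<^sub>F i in sequentially. n \<in> A (diagseq i) \<longleftrightarrow> n \<in> D" for n
    unfolding eventually_sequentially by blast
  then show ?thesis
    using subseq_diagseq by blast
qed

text \<open>Finitely many points of \<open>D\<close> leave almost all indices available, and
  finitely many indices leave infinitely many points of \<open>D\<close> available, so points and
  indices can be chosen in turn forever.\<close>

lemma infinite_subfamily_infinite_Inter:
  fixes A :: "nat \<Rightarrow> nat set"
  assumes lim: "\<And>n. n \<in> D \<Longrightarrow> \<forall>\<^sub>F i in sequentially. n \<in> A i"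
    and meet: "\<And>m. infinite (D \<inter> (\<Inter>i<m. A i))"
  shows "\<exists>J. infinite J \<and> infinite (\<Inter>i\<in>J. A i)"
proof -
  \<comment> \<open>The finite approximations: points \<open>N\<close> and indices \<open>J\<close>.
    Keeping \<open>N\<close> inside \<open>D\<close> lets \<open>lim\<close> apply to the old points
    at every later stage.\<close>
  define Q where "Q = (\<lambda>(N, J). finite N \<and> finite J \<and> N \<subseteq> D \<and> (\<forall>n\<in>N. \<forall>i\<in>J. n \<in> A i))"
  have "\<exists>T. Q T \<and> fst S \<subset> fst T \<and> snd S \<subset> snd T" if "Q S" for S
  proof -
    obtain N J where S: "S = (N, J)" by force
    have fin: "finite N" "finite J" "N \<subseteq> D" and all: "\<forall>n\<in>N. \<forall>i\<in>J. n \<in> A i"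
      using that by (auto simp: Q_def S)
    obtain m where m: "J \<subseteq> {..<m}"
      using fin finite_nat_iff_bounded by blast
    \<comment> \<open>Since \<open>J\<close> lies below \<open>m\<close>, a point of this set
      belongs to every term chosen so far; removing \<open>N\<close> makes it new.\<close>
    have "D \<inter> (\<Inter>i<m. A i) - N \<noteq> {}"
      by (intro infinite_imp_nonempty Diff_infinite_finite fin(1) meet)
    then obtain n where n: "n \<in> D" "\<forall>i<m. n \<in> A i" "n \<notin> N"
      by auto
    have "\<forall>\<^sub>F i in sequentially. \<forall>k\<in>insert n N. k \<in> A i"
      using fin n lim by (intro eventually_ball_finite) auto
    then have "\<forall>\<^sub>F i in sequentially. (\<forall>k\<in>insert n N. k \<in> A i) \<and> m \<le> i"
      using eventually_ge_at_top eventually_conj by blast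
    \<comment> \<open>The requirement \<open>m \<le> i\<close> makes the index new, again because
      \<open>J\<close> lies below \<open>m\<close>.\<close>
    then obtain i where i: "\<forall>k\<in>insert n N. k \<in> A i" "m \<le> i"
      unfolding eventually_sequentially by blast
    have "Q (insert n N, insert i J)"
      using fin all n m i by (auto simp: Q_def)
    moreover have "i \<notin> J"
      using m i by auto
    ultimately show ?thesis
      using n(3) by (intro exI[of _ "(insert n N, insert i J)"]) (auto simp: S)
  qed
  moreover have "Q ({}, {})"
    by (simp add: Q_def)
  ultimately obtain S :: "nat \<Rightarrow> nat set \<times> nat set"
    where S: "\<And>k. Q (S k)" "\<And>k. fst (S k) \<subset> fst (S (Suc k))" "\<And>k. snd (S k) \<subset> snd (S (Suc k))"
    using dependent_nat_choice[of "\<lambda>_. Q" "\<lambda>_ S T. fst S \<subset> fst T \<and> snd S \<subset> snd T"] by metis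
  \<comment> \<open>A finite union would have only finitely many subsets, whereas a strictly
    increasing chain is injective.\<close>
  have union: "infinite (\<Union>(range F))" if "\<And>k. F k \<subset> F (Suc k)" for F :: "nat \<Rightarrow> nat set"
  proof
    assume "finite (\<Union>(range F))"
    then have "finite (range F)"
      by (rule finite_UnionD)
    moreover have "strict_mono F"
      using that by (simp add: strict_mono_Suc_iff)
    ultimately show False
      using finite_imageD[of F UNIV] strict_mono_imp_inj_on[of F] by simp
  qed
  have mono: "mono (\<lambda>k. fst (S k))" "mono (\<lambda>k. snd (S k))"
    using S(2,3) by (auto simp: mono_iff_le_Suc)
  \<comment> \<open>A point and an index may enter at different stages; both are present at the
    later one.\<close>
  have "n \<in> A i" if "n \<in> fst (S k)" "i \<in> snd (S l)" for n i k l
  proof -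
    have "n \<in> fst (S (max k l))" "i \<in> snd (S (max k l))"
      using that monoD[OF mono(1), of k "max k l"] monoD[OF mono(2), of l "max k l"] by auto
    then show ?thesis
      using S(1)[of "max k l"] by (auto simp: Q_def split: prod.splits)
  qed
  then have "(\<Union>k. fst (S k)) \<subseteq> (\<Inter>i\<in>(\<Union>k. snd (S k)). A i)"
    by blast
  then show ?thesis
    using union[of "\<lambda>k. fst (S k)"] union[of "\<lambda>k. snd (S k)"] S(2,3) infinite_super by metis
qed

text \<open>The hypothesis is condition (i) with the exponents encoded by two disjoint index sets;
  the conclusion will violate (ii) for a constant exponent.\<close>

lemma independent_sequence_infinite_Inter:
  fixes A :: "nat \<Rightarrow> nat set"
  assumes indep: "\<And>F G. finite F \<Longrightarrow> finite G \<Longrightarrow> F \<inter> G = {} \<Longrightarrow>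
    infinite ((\<Inter>i\<in>F. A i) \<inter> (\<Inter>i\<in>G. - A i))"
  shows "\<exists>J. infinite J \<and> (infinite (\<Inter>i\<in>J. A i) \<or> infinite (\<Inter>i\<in>J. - A i))"
proof -
  obtain r D where r: "strict_mono (r :: nat \<Rightarrow> nat)"
    and lim: "\<And>n. \<forall>\<^sub>F i in sequentially. n \<in> A (r i) \<longleftrightarrow> n \<in> D"
    using pointwise_convergent_subsequence[of A] by blast
  have inj: "inj r"
    using r strict_mono_imp_inj_on by blast
  show ?thesis
  proof (cases "\<forall>m. infinite (D \<inter> (\<Inter>i<m. A (r i)))")
    case True
    have "\<exists>J. infinite J \<and> infinite (\<Inter>i\<in>J. A (r i))"
      by (rule infinite_subfamily_infinite_Inter[of D])
        (use True in \<open>auto intro: eventually_mono[OF lim]\<close>)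
    then obtain J where J: "infinite J" "infinite (\<Inter>i\<in>J. A (r i))"
      by blast
    have "infinite (r ` J)"
      using J finite_image_iff[OF inj_on_subset[OF inj subset_UNIV]] by simp
    with J(2) show ?thesis
      by (intro exI[of _ "r ` J"]) (simp add: image_image)
  next
    case False
    then obtain m where m: "finite (D \<inter> (\<Inter>i<m. A (r i)))"
      by blast
    \<comment> \<open>Skipping the first \<open>m\<close> terms keeps them disjoint from the
      complemented ones, so that \<open>indep\<close> applies to both together.\<close>
    define s where "s i = r (i + m)" for i
    have "infinite (- D \<inter> (\<Inter>i<k. - A (s i)))" for k
    proof -
      have "r ` {..<m} \<inter> s ` {..<k} = {}"
        using inj by (auto simp: s_def inj_eq)
      then have "infinite ((\<Inter>i\<in>r ` {..<m}. A i) \<inter> (\<Inter>i\<in>s ` {..<k}. - A i))"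
        by (intro indep) auto
      \<comment> \<open>Only a finite set is removed, and what remains lies in the first
        \<open>m\<close> terms, hence outside \<open>D\<close>.\<close>
      then have "infinite (((\<Inter>i<m. A (r i)) \<inter> (\<Inter>i<k. - A (s i))) - D \<inter> (\<Inter>i<m. A (r i)))"
        using m by (simp add: image_image Diff_infinite_finite)
      then show ?thesis
        by (rule infinite_super[rotated]) auto
    qed
    moreover have "\<forall>\<^sub>F i in sequentially. n \<in> - A (s i)" if "n \<in> - D" for n
      using lim[of n] that unfolding s_def
      by (subst (asm) eventually_sequentially_seg[of _ m, symmetric]) (auto elim: eventually_mono)
    ultimately obtain J where J: "infinite J" "infinite (\<Inter>i\<in>J. - A (s i))"
      using infinite_subfamily_infinite_Inter[of "- D" "\<lambda>i. - A (s i)"] by blast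
    have "inj_on s J"
      by (rule inj_onI) (simp add: s_def inj_eq[OF inj])
    then have "infinite (s ` J)"
      using J by (simp add: finite_image_iff)
    with J(2) show ?thesis
      by (intro exI[of _ "s ` J"]) (simp add: image_image)
  qed
qed

theorem proposition3p4:
  shows "\<not> (\<exists>\<I> :: nat set set. barely_independent \<I>)"
proof
  assume "\<exists>\<I> :: nat set set. barely_independent \<I>"
  then obtain \<I> :: "nat set set" where "barely_independent \<I>"
    by blast
  note I = this[unfolded barely_independent_def]
  have i: "infinite (\<Inter>(family_exp \<A> h))"
    if "\<A> \<subseteq> \<I>" "finite \<A>" "h \<in> \<A> \<rightarrow> {0, 1}" for \<A> h
    using I that by simp
  have ii: "finite (\<Inter>(family_exp \<A> h))"
    if "\<A> \<subseteq> \<I>" "countable \<A>" "infinite \<A>" "h \<in> \<A> \<rightarrow> {0, 1}" for \<A> h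
    using I that by simp
  obtain A :: "nat \<Rightarrow> nat set" where A: "inj A" "range A \<subseteq> \<I>"
    using infinite_countable_subset[of \<I>] I by auto
  have "infinite ((\<Inter>i\<in>F. A i) \<inter> (\<Inter>i\<in>G. - A i))" if "finite F" "finite G" "F \<inter> G = {}" for F G
  proof -
    \<comment> \<open>Exponents belong to sets, not indices; injectivity of \<open>A\<close> and
      disjointness of \<open>F\<close> and \<open>G\<close> ensure that terms from \<open>G\<close>
      get exponent 1.\<close>
    define h where "h X = (if X \<in> A ` F then 0 else 1 :: nat)" for X
    have F: "set_exp (A i) (h (A i)) = A i" if "i \<in> F" for i
      using that by (simp add: h_def set_exp_def)
    have G: "set_exp (A i) (h (A i)) = - A i" if "i \<in> G" for i
      using that \<open>F \<inter> G = {}\<close> A(1) by (auto simp: h_def set_exp_def inj_eq)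
    have "family_exp (A ` (F \<union> G)) h = (\<lambda>i. set_exp (A i) (h (A i))) ` (F \<union> G)"
      by (auto simp: family_exp_def)
    also have "\<dots> = A ` F \<union> (\<lambda>i. - A i) ` G"
      using F G by (simp add: image_Un)
    finally have "\<Inter>(family_exp (A ` (F \<union> G)) h) = (\<Inter>i\<in>F. A i) \<inter> (\<Inter>i\<in>G. - A i)"
      by (simp only: Inter_Un_distrib)
    moreover have "infinite (\<Inter>(family_exp (A ` (F \<union> G)) h))"
      using that A(2) by (intro i) (auto simp: h_def)
    ultimately show ?thesis
      by simp
  qed
  then obtain J where J: "infinite J" "infinite (\<Inter>i\<in>J. A i) \<or> infinite (\<Inter>i\<in>J. - A i)"
    using independent_sequence_infinite_Inter by blast
  have "infinite (A ` J)"
    using J(1) finite_image_iff[OF inj_on_subset[OF A(1) subset_UNIV]] by simp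
  \<comment> \<open>The constant exponents 0 and 1 exclude the two alternatives for
    \<open>J\<close>.\<close>
  then have "finite (\<Inter>(family_exp (A ` J) (\<lambda>_. c)))" if "c \<in> {0, 1}" for c
    using that A(2) by (intro ii) auto
  from this[of 0] this[of 1] have "finite (\<Inter>i\<in>J. A i)" "finite (\<Inter>i\<in>J. - A i)"
    by (simp_all add: family_exp_def set_exp_def Setcompr_eq_image image_image Compl_eq_Diff_UNIV)
  with J(2) show False
    by blast
qed

end
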